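(* Let $\Sigma$ be a finite alphabet and let $X\subset\Sigma^{\mathbb{N}}$ be a mixing sofic shift. Then $X$ with the Besicovitch topology is contractible, i.e. homotopy equivalent to a one-point space.
   Context: Subshifts here are one-sided: a subshift is a subset of $\Sigma^{\mathbb{N}}$ that is closed in the product (Cantor) topology and shift-invariant, where the shift is $\sigma(x)_i = x_{i+1}$. A sofic shift is a subshift presented by a finite labeled graph. A sofic shift $X$ is mixing if it is nonempty and there is $m$ such that for all words $u,v$ occurring in $X$ and all $n\ge m$ there is a word $w$ of length $n$ such that $uwv$ occurs in $X$. The Besicovitch topology on $\Sigma^{\mathbb{N}}$ (and on its subsets) is given by the pseudometric $d_B(x,y)=\limsup_{n\to\infty} \frac{1}{n+1}|\{i\in[0,n] : x_i\neq y_i\}|$. Continuity and homotopies are taken with respect to this (not necessarily Hausdorff) topology. *)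

theory Defs
  imports "HOL-Analysis.Analysis"
begin

definition shift :: "(nat \<Rightarrow> 'a) \<Rightarrow> (nat \<Rightarrow> 'a)" where
  "shift x = (\<lambda>i. x (Suc i))"

text \<open>Shift-invariance is the inclusion \<open>\<sigma>(X) \<subseteq> X\<close>; equality is not required.\<close>

definition subshift :: "'a set \<Rightarrow> (nat \<Rightarrow> 'a) set \<Rightarrow> bool" where
  "subshift \<Sigma> X \<longleftrightarrow>
     closedin (product_topology (\<lambda>_. discrete_topology \<Sigma>) UNIV) X \<and> shift ` X \<subseteq> X"

text \<open>A labeled graph is given by its set of edges (source, label, target). It presents the
  set of label sequences of its one-sided infinite walks, so isolated vertices and repeated
  edges with the same ends and label play no role.\<close>

definition presented_by :: "('v \<times> 'a \<times> 'v) set \<Rightarrow> (nat \<Rightarrow> 'a) set" where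
  "presented_by E = {x. \<exists>p. \<forall>i. (p i, x i, p (Suc i)) \<in> E}"

text \<open>Vertices of a finite graph can be taken to be natural numbers without loss of generality.\<close>

definition sofic_shift :: "'a set \<Rightarrow> (nat \<Rightarrow> 'a) set \<Rightarrow> bool" where
  "sofic_shift \<Sigma> X \<longleftrightarrow> subshift \<Sigma> X \<and>
     (\<exists>E :: (nat \<times> 'a \<times> nat) set. finite E \<and> E \<subseteq> UNIV \<times> \<Sigma> \<times> UNIV \<and> X = presented_by E)"

text \<open>The finite words occurring in \<open>X\<close>, at any position and including the empty word.\<close>

definition language :: "(nat \<Rightarrow> 'a) set \<Rightarrow> 'a list set" where
  "language X = {map x [i..<j] | x i j. x \<in> X}"

definition mixing :: "(nat \<Rightarrow> 'a) set \<Rightarrow> bool" where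
  "mixing X \<longleftrightarrow> X \<noteq> {} \<and>
     (\<exists>m. \<forall>u\<in>language X. \<forall>v\<in>language X. \<forall>n\<ge>m. \<exists>w. length w = n \<and> u @ w @ v \<in> language X)"

definition besicovitch_dist :: "(nat \<Rightarrow> 'a) \<Rightarrow> (nat \<Rightarrow> 'a) \<Rightarrow> real" where
  "besicovitch_dist x y =
     real_of_ereal (limsup (\<lambda>n. ereal (real (card {i \<in> {0..n}. x i \<noteq> y i}) / real (n + 1))))"

text \<open>The limsup is finite, so the coercion to the reals loses nothing.\<close>

lemma ereal_besicovitch_dist:
  "ereal (besicovitch_dist x y) =
     limsup (\<lambda>n. ereal (real (card {i \<in> {0..n}. x i \<noteq> y i}) / real (n + 1)))"
proof -
  let ?f = "\<lambda>n. ereal (real (card {i \<in> {0..n}. x i \<noteq> y i}) / real (n + 1))"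
  have "card {i \<in> {0..n}. x i \<noteq> y i} \<le> n + 1" for n
    using card_mono[of "{0..n}" "{i \<in> {0..n}. x i \<noteq> y i}"]
    by (metis (no_types, lifting) Suc_eq_plus1 card_atLeastAtMost diff_zero finite_atLeastAtMost
        mem_Collect_eq subsetI)
  then have "?f n \<le> ereal 1" for n
    by (subst ereal_less_eq(3), subst divide_le_eq_1) (auto simp del: of_nat_Suc of_nat_add)
  then have "?f n \<le> 1" for n
    by (simp only: one_ereal_def)
  then have le: "limsup ?f \<le> 1"
    by (intro Limsup_bounded) simp
  have "0 \<le> liminf ?f"
    by (intro Liminf_bounded) simp
  also have "\<dots> \<le> limsup ?f"
    by (intro Liminf_le_Limsup) simp
  finally have "\<bar>limsup ?f\<bar> \<noteq> \<infinity>"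
    using le by auto
  then show ?thesis
    by (simp add: besicovitch_dist_def ereal_real)
qed

text \<open>The topology of the pseudometric. It need not be Hausdorff, since distinct points may
  have distance zero. A set \<open>X\<close> of sequences carries the subspace topology, which is the topology
  of the restricted pseudometric.\<close>

definition besicovitch_topology :: "(nat \<Rightarrow> 'a) topology" where
  "besicovitch_topology =
     topology (\<lambda>U. \<forall>x\<in>U. \<exists>r>0. \<forall>y. besicovitch_dist x y < r \<longrightarrow> y \<in> U)"

lemma openin_besicovitch_topology:
  "openin besicovitch_topology U \<longleftrightarrow>
     (\<forall>x\<in>U. \<exists>r>0. \<forall>y. besicovitch_dist x y < r \<longrightarrow> y \<in> U)"
proof -
  have "istopology (\<lambda>U. \<forall>x\<in>U. \<exists>r>0. \<forall>y::nat \<Rightarrow> 'a. besicovitch_dist x y < r \<longrightarrow> y \<in> U)"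
    unfolding istopology_def
  proof (intro conjI allI impI ballI)
    fix S T :: "(nat \<Rightarrow> 'a) set" and x
    assume "\<forall>x\<in>S. \<exists>r>0. \<forall>y. besicovitch_dist x y < r \<longrightarrow> y \<in> S"
      and "\<forall>x\<in>T. \<exists>r>0. \<forall>y. besicovitch_dist x y < r \<longrightarrow> y \<in> T" and "x \<in> S \<inter> T"
    then obtain r s where "r > 0" "\<forall>y. besicovitch_dist x y < r \<longrightarrow> y \<in> S"
      and "s > 0" "\<forall>y. besicovitch_dist x y < s \<longrightarrow> y \<in> T" by blast
    then show "\<exists>r>0. \<forall>y. besicovitch_dist x y < r \<longrightarrow> y \<in> S \<inter> T"
      by (intro exI[of _ "min r s"]) auto
  next
    fix K :: "(nat \<Rightarrow> 'a) set set" and x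
    assume "\<forall>S\<in>K. \<forall>x\<in>S. \<exists>r>0. \<forall>y. besicovitch_dist x y < r \<longrightarrow> y \<in> S" and "x \<in> \<Union>K"
    then show "\<exists>r>0. \<forall>y. besicovitch_dist x y < r \<longrightarrow> y \<in> \<Union>K" by (meson UnionE UnionI)
  qed
  then show ?thesis
    by (simp add: besicovitch_topology_def topology_inverse')
qed

lemma topspace_besicovitch_topology [simp]: "topspace besicovitch_topology = UNIV"
  by (meson UNIV_I openin_besicovitch_topology openin_subset top.extremum_uniqueI zero_less_one)

end

theory Submission
  imports Defs "HOL-Real_Asymp.Real_Asymp"
begin

text \<open>Mixing is the specification property with a fixed gap \<open>m\<close>: points of \<open>X\<close> can be glued
  along consecutive blocks at the cost of \<open>m\<close> free positions per block. Fix \<open>z \<in> X\<close> and, for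
  \<open>0 \<le> t \<le> 1\<close>, let the sequence \<open>P t x\<close> agree with \<open>z\<close> on the first fraction \<open>t\<close> of each dyadic
  block \<open>[2^k, 2^(k+1))\<close> and with \<open>x\<close> elsewhere. Then \<open>P\<close> is jointly continuous for the
  Besicovitch pseudometric but may leave \<open>X\<close>. Only \<open>O(log n)\<close> block boundaries lie below \<open>n\<close>,
  so gluing gives points of \<open>X\<close> at distance \<open>0\<close> from \<open>P t x\<close>; since distance \<open>0\<close> is invisible
  to the topology, any choice of such points, with \<open>x\<close> itself for \<open>t = 0\<close> and \<open>z\<close> for \<open>t = 1\<close>, is a
  continuous contraction.\<close>

section \<open>The Besicovitch pseudometric\<close>

text \<open>Dividing the count by \<open>n + 1\<close> kills the constant and logarithmic terms in
  the limit, so only the linear rate \<open>c\<close> survives. Errors made once per block boundary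
  thus cost nothing.\<close>

lemma besicovitch_dist_le:
  assumes "\<And>n. real (card {i \<in> {0..n}. x i \<noteq> y i}) \<le> c * real (n + 1) + a + b * log 2 (real (n + 1))"
  shows "besicovitch_dist x y \<le> c"
proof -
  let ?g = "\<lambda>n. c + (a + b * log 2 (real (n + 1))) / real (n + 1)"
  have "?g \<longlonglongrightarrow> c"
    by real_asymp
  then have lim: "limsup (\<lambda>n. ereal (?g n)) = ereal c"
    by (intro lim_imp_Limsup tendsto_ereal) auto
  have "real (card {i \<in> {0..n}. x i \<noteq> y i}) / real (n + 1) \<le> ?g n" for n
    using divide_right_mono[OF assms[of n], of "real (n + 1)"]
    by (simp add: add_divide_distrib add.assoc del: of_nat_Suc of_nat_add)
  then have "ereal (besicovitch_dist x y) \<le> ereal c"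
    unfolding ereal_besicovitch_dist lim[symmetric] by (intro Limsup_mono always_eventually) auto
  then show ?thesis by simp
qed

text \<open>Gives symmetry at once, and later shows that interpolating two points towards the same
  \<open>z\<close> at the same time never increases their distance.\<close>

lemma besicovitch_dist_mono:
  assumes "\<And>i. u i \<noteq> v i \<Longrightarrow> x i \<noteq> y i"
  shows "besicovitch_dist u v \<le> besicovitch_dist x y"
proof -
  have "card {i \<in> {0..n}. u i \<noteq> v i} \<le> card {i \<in> {0..n}. x i \<noteq> y i}" for n
    using assms by (intro card_mono) auto
  then have "ereal (besicovitch_dist u v) \<le> ereal (besicovitch_dist x y)"
    unfolding ereal_besicovitch_dist
    by (intro Limsup_mono always_eventually) (auto simp: divide_right_mono)
  then show ?thesis by simp
qed

lemma besicovitch_dist_commute: "besicovitch_dist x y = besicovitch_dist y x"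
  by (intro antisym besicovitch_dist_mono) auto

lemma besicovitch_dist_refl [simp]: "besicovitch_dist x x = 0"
  by (simp add: besicovitch_dist_def Limsup_const flip: zero_ereal_def)

lemma besicovitch_dist_triangle:
  "besicovitch_dist x z \<le> besicovitch_dist x y + besicovitch_dist y z"
proof -
  define f where "f x y n = ereal (real (card {i \<in> {0..n}. x i \<noteq> y i}) / real (n + 1))"
    for x y :: "nat \<Rightarrow> 'a" and n
  have "card {i \<in> {0..n}. x i \<noteq> z i} \<le> card {i \<in> {0..n}. x i \<noteq> y i} + card {i \<in> {0..n}. y i \<noteq> z i}" for n
    by (rule order_trans[OF card_mono card_Un_le]) auto
  then have "f x z n \<le> f x y n + f y z n" for n
    by (simp add: f_def divide_simps del: of_nat_Suc of_nat_add flip: of_nat_add)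
  then have "limsup (f x z) \<le> limsup (\<lambda>n. f x y n + f y z n)"
    by (intro Limsup_mono always_eventually) auto
  also have "\<dots> \<le> limsup (f x y) + limsup (f y z)"
    by (rule ereal_limsup_add_mono)
  finally have "ereal (besicovitch_dist x z) \<le> ereal (besicovitch_dist x y) + ereal (besicovitch_dist y z)"
    unfolding f_def ereal_besicovitch_dist .
  then show ?thesis by simp
qed

lemma openin_besicovitch_ball: "openin besicovitch_topology {y. besicovitch_dist x y < r}"
  unfolding openin_besicovitch_topology
proof clarsimp
  fix y assume "besicovitch_dist x y < r"
  then show "\<exists>s>0. \<forall>w. besicovitch_dist y w < s \<longrightarrow> besicovitch_dist x w < r"
    by (intro exI[of _ "r - besicovitch_dist x y"])
      (smt (verit) besicovitch_dist_triangle)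
qed

lemma continuous_map_besicovitch_homotopy:
  fixes H :: "real \<times> (nat \<Rightarrow> 'a) \<Rightarrow> (nat \<Rightarrow> 'a)"
  assumes maps: "\<And>t x. t \<in> {0..1} \<Longrightarrow> x \<in> X \<Longrightarrow> H (t, x) \<in> X"
    and lipschitz: "\<And>t s x y. \<lbrakk>t \<in> {0..1}; s \<in> {0..1}; x \<in> X; y \<in> X\<rbrakk> \<Longrightarrow>
      besicovitch_dist (H (t, x)) (H (s, y)) \<le> C * \<bar>t - s\<bar> + besicovitch_dist x y"
    and "C > 0"
  shows "continuous_map (prod_topology (top_of_set {0..1}) (subtopology besicovitch_topology X))
    (subtopology besicovitch_topology X) H"
proof -
  let ?P = "prod_topology (top_of_set {0..1::real}) (subtopology besicovitch_topology X)"
  have "openin ?P {p \<in> topspace ?P. H p \<in> U}" if U: "openin besicovitch_topology U" for U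
    unfolding openin_prod_topology_alt
  proof (intro allI impI)
    fix t x assume "(t, x) \<in> {p \<in> topspace ?P. H p \<in> U}"
    then have t: "t \<in> {0..1}" "x \<in> X" "H (t, x) \<in> U" by auto
    with U obtain r where r: "r > 0" "\<And>y. besicovitch_dist (H (t, x)) y < r \<Longrightarrow> y \<in> U"
      unfolding openin_besicovitch_topology by blast
    \<comment> \<open>The radius \<open>r\<close> is split evenly: moving the time by less than
      \<open>r / (2 * C)\<close> costs less than \<open>r / 2\<close>, and moving the point costs
      less than the other half.\<close>
    let ?V = "{0..1} \<inter> ball t (r / (2 * C))" and ?W = "X \<inter> {y. besicovitch_dist x y < r / 2}"
    have "H (s, y) \<in> U" if "s \<in> ?V" "y \<in> ?W" for s y
    proof (rule r(2))
      have "C * \<bar>t - s\<bar> < r / 2"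
        using that \<open>C > 0\<close> by (auto simp: dist_real_def field_simps)
      then show "besicovitch_dist (H (t, x)) (H (s, y)) < r"
        using lipschitz[of t s x y] that t by auto
    qed
    then have "?V \<times> ?W \<subseteq> {p \<in> topspace ?P. H p \<in> U}" by auto
    moreover have "openin (top_of_set {0..1}) ?V"
      by (rule openin_open_Int) simp
    moreover have "openin (subtopology besicovitch_topology X) ?W"
      by (rule openin_subtopology_Int2) (rule openin_besicovitch_ball)
    ultimately show "\<exists>V W. openin (top_of_set {0..1}) V \<and> openin (subtopology besicovitch_topology X) W \<and>
        t \<in> V \<and> x \<in> W \<and> V \<times> W \<subseteq> {p \<in> topspace ?P. H p \<in> U}"
      using t r(1) \<open>C > 0\<close> by (intro exI[of _ ?V] exI[of _ ?W]) auto
  qed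
  then have "continuous_map ?P besicovitch_topology H"
    by (simp add: continuous_map)
  then show ?thesis
    using maps by (auto simp: continuous_map_in_subtopology)
qed

section \<open>Gluing in mixing subshifts\<close>

lemma map_upt_in_language: "x \<in> X \<Longrightarrow> map x [i..<j] \<in> language X"
  unfolding language_def by blast

text \<open>A word may occur at any position; iterating the shift moves that occurrence to the start
  of another point of \<open>X\<close>.\<close>

lemma language_prefix:
  assumes "shift ` X \<subseteq> X" and "w \<in> language X"
  obtains y where "y \<in> X" and "w = map y [0..<length w]"
proof -
  obtain x i j where x: "w = map x [i..<j]" "x \<in> X"
    using assms(2) by (auto simp: language_def)
  have "(\<lambda>l. x (l + i)) \<in> X"
  proof (induction i)
    case 0
    then show ?case using x by simp
  next
    case (Suc i)
    then have "shift (\<lambda>l. x (l + i)) \<in> X" using assms(1) by blast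
    then show ?case by (simp add: shift_def)
  qed
  moreover have "w = map (\<lambda>l. x (l + i)) [0..<length w]"
    using x by (auto intro!: nth_equalityI simp: add.commute)
  ultimately show ?thesis using that by blast
qed

text \<open>The approximating points converge coordinatewise, coordinate \<open>i\<close> being
  constant as soon as \<open>n > i\<close>, and a closed set contains the limit.\<close>

lemma in_closed_if_prefixes:
  fixes X :: "(nat \<Rightarrow> 'a) set"
  assumes cl: "closedin (product_topology (\<lambda>_. discrete_topology \<Sigma>) UNIV) X"
    and pre: "\<And>n. \<exists>y\<in>X. \<forall>i<n. y i = q i"
  shows "q \<in> X"
proof -
  let ?T = "product_topology (\<lambda>_::nat. discrete_topology \<Sigma>) UNIV"
  obtain y where y: "\<And>n. y n \<in> X" "\<And>n i. i < n \<Longrightarrow> y n i = q i"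
    using pre by metis
  have top: "y n \<in> topspace ?T" for n
    using closedin_subset[OF cl] y(1) by blast
  have "limitin (discrete_topology \<Sigma>) (\<lambda>n. y n i) (q i) sequentially" for i
  proof (rule limitin_eventually)
    have "y (Suc i) i \<in> \<Sigma>" using top[of "Suc i"] by (auto simp: PiE_iff)
    then show "q i \<in> topspace (discrete_topology \<Sigma>)" using y(2)[of i "Suc i"] by simp
    show "\<forall>\<^sub>F n in sequentially. y n i = q i"
      using y(2) by (auto simp: eventually_at_top_dense)
  qed
  then have "limitin ?T y q sequentially"
    using top by (auto simp: limitin_componentwise)
  then show ?thesis
    by (rule limitin_closedin[OF _ cl]) (use y in auto)
qed

text \<open>Words of the language are extended step by step: a connecting word of length
  \<open>m\<close>, then the stretch of \<open>c j\<close> that belongs at the same positions. The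
  limit of these nested words lies in \<open>X\<close> by closedness. The gap \<open>m\<close> is
  fixed before \<open>b\<close> and \<open>c\<close>; the positions below \<open>b 0\<close> are
  left free.\<close>

lemma mixing_glue:
  assumes cl: "closedin (product_topology (\<lambda>_. discrete_topology \<Sigma>) UNIV) X"
    and sh: "shift ` X \<subseteq> X" and "mixing X"
  obtains m where "\<And>b c. \<lbrakk>\<And>j. b j + m < b (Suc j); \<And>j. c j \<in> X\<rbrakk> \<Longrightarrow>
    \<exists>q\<in>X. \<forall>j. \<forall>i\<in>{b j + m..<b (Suc j)}. q i = c j i"
proof -
  obtain m where m: "\<And>u v. \<lbrakk>u \<in> language X; v \<in> language X\<rbrakk> \<Longrightarrow>
      \<exists>w. length w = m \<and> u @ w @ v \<in> language X"
    using \<open>mixing X\<close> unfolding mixing_def by (metis order_refl)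
  have "\<exists>q\<in>X. \<forall>j. \<forall>i\<in>{b j + m..<b (Suc j)}. q i = c j i"
    if b: "\<And>j. b j + m < b (Suc j)" and c: "\<And>j. c j \<in> X" for b c
  proof -
    have "\<exists>W. \<forall>j. (W j \<in> language X \<and> length (W j) = b j) \<and>
        (\<exists>w. length w = m \<and> W (Suc j) = W j @ w @ map (c j) [b j + m..<b (Suc j)])"
    proof (rule dependent_nat_choice)
      \<comment> \<open>The initial word only has to have length \<open>b 0\<close>; a prefix of
        \<open>c 0\<close> serves.\<close>
      show "\<exists>u. u \<in> language X \<and> length u = b 0"
        using map_upt_in_language[OF c, of 0 0 "b 0"] by (metis length_map length_upt diff_zero)
    next
      fix u j assume u: "u \<in> language X \<and> length u = b j"
      let ?v = "map (c j) [b j + m..<b (Suc j)]"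
      obtain w where "length w = m" "u @ w @ ?v \<in> language X"
        using m[of u ?v] u map_upt_in_language[OF c] by blast
      then show "\<exists>u'. (u' \<in> language X \<and> length u' = b (Suc j)) \<and>
          (\<exists>w. length w = m \<and> u' = u @ w @ ?v)"
        using u b[of j] by (intro exI[of _ "u @ w @ ?v"]) auto
    qed
    then obtain W where W: "\<And>j. W j \<in> language X" "\<And>j. length (W j) = b j"
      and W_Suc: "\<And>j. \<exists>w. length w = m \<and> W (Suc j) = W j @ w @ map (c j) [b j + m..<b (Suc j)]"
      by blast
    have "strict_mono b"
      unfolding strict_mono_Suc_iff using b add_lessD1 by blast
    then have le: "j \<le> b j" and mono: "j \<le> k \<Longrightarrow> b j \<le> b k" for j k
      by (auto simp: strict_mono_imp_increasing strict_mono_less_eq)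
    have nth_le: "W k ! i = W j ! i" if "j \<le> k" "i < b j" for i j k
      using that(1)
    proof (induction k rule: dec_induct)
      case (step k)
      obtain w where "W (Suc k) = W k @ w" using W_Suc by blast
      then show ?case using step that mono[of j k] W(2)[of k] by (simp add: nth_append)
    qed simp
    \<comment> \<open>The limit of the nested words: \<open>W (Suc i)\<close> is long enough to be
      read at \<open>i\<close>, since \<open>Suc i \<le> b (Suc i)\<close>.\<close>
    define q where "q i = W (Suc i) ! i" for i
    have q: "q i = W j ! i" if "i < b j" for i j
      using nth_le[of j "Suc i" i] nth_le[of "Suc i" j i] that le[of "Suc i"]
      by (cases "j \<le> Suc i") (auto simp: q_def)
    have "q \<in> X"
    proof (rule in_closed_if_prefixes[OF cl])
      fix n
      obtain y where y: "y \<in> X" "W n = map y [0..<length (W n)]"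
        using language_prefix[OF sh W(1)] by blast
      have "y i = q i" if "i < n" for i
      proof -
        have i: "i < b n" using that le[of n] by simp
        then have "W n ! i = y i" by (subst y(2)) (simp add: W(2))
        then show ?thesis using q[OF i] by simp
      qed
      then show "\<exists>y\<in>X. \<forall>i<n. y i = q i" using y(1) by blast
    qed
    moreover have "q i = c j i" if i: "i \<in> {b j + m..<b (Suc j)}" for i j
    proof -
      obtain w where "length w = m" "W (Suc j) = W j @ w @ map (c j) [b j + m..<b (Suc j)]"
        using W_Suc by blast
      moreover have "\<not> i - b j < m" and "b j + m + (i - (b j + m)) = i" using i by auto
      ultimately have "W (Suc j) ! i = c j i"
        using i W(2)[of j] by (simp add: nth_append)
      then show ?thesis using q[of i "Suc j"] i by simp
    qed
    ultimately show ?thesis by blast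
  qed
  then show ?thesis using that by blast
qed

section \<open>Interpolation along dyadic blocks\<close>

text \<open>Position \<open>0\<close> lies in no dyadic block, so \<open>interpolate\<close> keeps
  the value of \<open>x\<close> there even for \<open>t = 1\<close>.\<close>

definition dyadic_part :: "real \<Rightarrow> nat set" where
  "dyadic_part t = {i. \<exists>k::nat. 2 ^ k \<le> i \<and> real i < (1 + t) * 2 ^ k}"

definition interpolate :: "(nat \<Rightarrow> 'a) \<Rightarrow> real \<Rightarrow> (nat \<Rightarrow> 'a) \<Rightarrow> (nat \<Rightarrow> 'a)" where
  "interpolate z t x = (\<lambda>i. if i \<in> dyadic_part t then z i else x i)"

text \<open>For \<open>t \<le> 1\<close> the interval starting at \<open>2 ^ l\<close> stays inside
  its own block, so a witness for membership of \<open>i\<close> must be the block that contains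
  \<open>i\<close>.\<close>

lemma dyadic_part_iff:
  assumes "2 ^ k \<le> i" "i < 2 ^ Suc k" "t \<le> 1"
  shows "i \<in> dyadic_part t \<longleftrightarrow> real i < (1 + t) * 2 ^ k"
proof
  assume "i \<in> dyadic_part t"
  then obtain l where l: "2 ^ l \<le> i" "real i < (1 + t) * 2 ^ l"
    by (auto simp: dyadic_part_def)
  have "(1 + t) * 2 ^ l \<le> 2 * 2 ^ l"
    using assms(3) by (intro mult_right_mono) auto
  with l(2) have "real i < 2 * 2 ^ l" by (rule less_le_trans)
  then have "real i < real (2 ^ Suc l)" by simp
  then have "i < 2 ^ Suc l" by (simp only: of_nat_less_iff)
  then have "(2::nat) ^ k < 2 ^ Suc l" "(2::nat) ^ l < 2 ^ Suc k" using assms l by linarith+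
  then have "k < Suc l" "l < Suc k" by (simp_all only: power_strict_increasing_iff[of "2::nat"] one_less_numeral_iff semiring_norm)
  then have "k = l" by simp
  then show "real i < (1 + t) * 2 ^ k" using l by simp
qed (use assms in \<open>auto simp: dyadic_part_def\<close>)

lemma card_nat_between: "real (card {i::nat. u \<le> real i \<and> real i < v}) \<le> max 0 (v - u) + 1"
proof (cases "u < v \<and> 0 < v")
  case True
  have "{i::nat. u \<le> real i \<and> real i < v} \<subseteq> {nat \<lceil>u\<rceil>..<nat \<lceil>v\<rceil>}"
    by (auto; linarith)
  then have "card {i::nat. u \<le> real i \<and> real i < v} \<le> nat \<lceil>v\<rceil> - nat \<lceil>u\<rceil>"
    by (metis card_mono card_atLeastLessThan finite_atLeastLessThan)
  then show ?thesis using True by linarith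
next
  case False
  then have "{i::nat. u \<le> real i \<and> real i < v} = {}" by auto
  then have "card {i::nat. u \<le> real i \<and> real i < v} = 0" by (metis card.empty)
  then show ?thesis by simp
qed

text \<open>Raising \<open>s\<close> to \<open>t\<close> only affects the stretches
  \<open>A k\<close>, with at most \<open>(t - s) * 2 ^ k + 1\<close> positions each. The geometric
  sum over the blocks meeting \<open>[0, n]\<close> yields the factor \<open>2\<close>; the rounding
  error of one position per block adds up to a logarithm.\<close>

lemma besicovitch_dist_interpolate:
  assumes "s \<le> t"
  shows "besicovitch_dist (interpolate z s x) (interpolate z t x) \<le> 2 * (t - s)"
proof (rule besicovitch_dist_le[where a = 1 and b = 1])
  fix n
  \<comment> \<open>Every dyadic block that meets \<open>[0, n]\<close> has index at most
    \<open>L\<close>.\<close>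
  define L where "L = nat \<lfloor>log 2 (real (n + 1))\<rfloor>"
  define A where "A k = {i::nat. (1 + s) * 2 ^ k \<le> real i \<and> real i < (1 + t) * 2 ^ k}" for k :: nat
  have fin: "finite (A k)" for k
  proof (rule finite_subset)
    show "A k \<subseteq> {..nat \<lceil>(1 + t) * 2 ^ k\<rceil>}" unfolding A_def by (auto; linarith)
  qed simp
  have L: "real L \<le> log 2 (real (n + 1))"
    unfolding L_def by (simp add: of_nat_nat)
  then have "2 ^ L \<le> real (n + 1)"
    by (subst (asm) le_log_iff) (auto simp: powr_realpow)
  have sub: "{i \<in> {0..n}. interpolate z s x i \<noteq> interpolate z t x i} \<subseteq> (\<Union>k\<le>L. A k)"
  proof
    fix i assume "i \<in> {i \<in> {0..n}. interpolate z s x i \<noteq> interpolate z t x i}"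
    then have i: "i \<le> n" and ne: "\<not> (i \<in> dyadic_part s \<longleftrightarrow> i \<in> dyadic_part t)"
      by (auto simp: interpolate_def split: if_splits)
    have "dyadic_part s \<subseteq> dyadic_part t"
    proof -
      have "(1 + s) * 2 ^ k \<le> (1 + t) * 2 ^ k" for k :: nat
        using assms by (intro mult_right_mono) auto
      then show ?thesis unfolding dyadic_part_def by (blast intro: less_le_trans)
    qed
    with ne have "i \<in> dyadic_part t" "i \<notin> dyadic_part s" by auto
    then obtain k where k: "2 ^ k \<le> i" "real i < (1 + t) * 2 ^ k" "\<not> real i < (1 + s) * 2 ^ k"
      unfolding dyadic_part_def by blast
    have "real k \<le> log 2 (real (n + 1))"
      using k(1) i by (intro le_log2_of_power) simp
    then have "k \<le> L" unfolding L_def by linarith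
    moreover have "i \<in> A k" using k by (simp add: A_def)
    ultimately show "i \<in> (\<Union>k\<le>L. A k)" by blast
  qed
  have "real (card {i \<in> {0..n}. interpolate z s x i \<noteq> interpolate z t x i}) \<le> real (card (\<Union>k\<le>L. A k))"
    by (rule of_nat_mono, rule card_mono[OF _ sub]) (use fin in blast)
  also have "\<dots> \<le> (\<Sum>k\<le>L. real (card (A k)))"
    unfolding of_nat_sum[symmetric] by (rule of_nat_mono, rule card_UN_le) simp
  also have "\<dots> \<le> (\<Sum>k\<le>L. (t - s) * 2 ^ k + 1)"
  proof (rule sum_mono)
    fix k
    have "0 \<le> (t - s) * 2 ^ k" using assms by simp
    moreover have "(1 + t) * 2 ^ k - (1 + s) * 2 ^ k = (t - s) * 2 ^ k"
      by (simp add: algebra_simps)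
    ultimately show "real (card (A k)) \<le> (t - s) * 2 ^ k + 1"
      using card_nat_between[of "(1 + s) * 2 ^ k" "(1 + t) * 2 ^ k"] unfolding A_def by linarith
  qed
  also have "\<dots> = (t - s) * (2 * 2 ^ L - 1) + real L + 1"
    by (induction L) (simp_all add: algebra_simps)
  also have "\<dots> \<le> (t - s) * (2 * real (n + 1)) + log 2 (real (n + 1)) + 1"
    using assms L \<open>2 ^ L \<le> real (n + 1)\<close> by (intro add_mono mult_left_mono) auto
  finally show "real (card {i \<in> {0..n}. interpolate z s x i \<noteq> interpolate z t x i})
      \<le> 2 * (t - s) * real (n + 1) + 1 + 1 * log 2 (real (n + 1))"
    by (simp add: algebra_simps)
qed

text \<open>Differences are confined to the start below \<open>b 0\<close> and to gaps of length
  \<open>m\<close>, of which only logarithmically many begin by \<open>n\<close>. The exponent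
  \<open>j div 2\<close> allows two boundaries per dyadic block.\<close>

lemma besicovitch_dist_zero_if_gaps:
  fixes b :: "nat \<Rightarrow> nat"
  assumes b: "\<And>j. b j < b (Suc j)" and growth: "\<And>j. 2 ^ (j div 2) \<le> b j"
    and agree: "\<And>i j. i \<in> {b j + m..<b (Suc j)} \<Longrightarrow> q i = p i"
  shows "besicovitch_dist q p \<le> 0"
proof (rule besicovitch_dist_le)
  fix n
  define L where "L = nat \<lfloor>log 2 (real (n + 1))\<rfloor>"
  have L: "real L \<le> log 2 (real (n + 1))"
    unfolding L_def by (simp add: of_nat_nat)
  have "{i \<in> {0..n}. q i \<noteq> p i} \<subseteq> {..<b 0} \<union> (\<Union>j\<le>2 * L + 1. {b j..<b j + m})"
  proof
    fix i assume i: "i \<in> {i \<in> {0..n}. q i \<noteq> p i}"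
    have "strict_mono b" using b by (simp add: strict_mono_Suc_iff)
    then have inc: "j \<le> b j" for j by (rule strict_mono_imp_increasing)
    show "i \<in> {..<b 0} \<union> (\<Union>j\<le>2 * L + 1. {b j..<b j + m})"
    proof (cases "i < b 0")
      case False
      \<comment> \<open>The last boundary at or before \<open>i\<close>; as \<open>q\<close> and
        \<open>p\<close> differ at \<open>i\<close>, this position lies in the gap right after
        \<open>b j\<close>.\<close>
      define j where "j = Max {j. b j \<le> i}"
      have fin: "finite {j. b j \<le> i}"
        by (rule finite_subset[of _ "{..i}"]) (use inc order_trans in auto)
      have "0 \<in> {j. b j \<le> i}" using False by simp
      then have j: "b j \<le> i" using Max_in[OF fin] unfolding j_def by blast
      have "\<not> b (Suc j) \<le> i" using Max_ge[OF fin, of "Suc j"] unfolding j_def by auto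
      then have m: "i < b j + m" using agree[of i j] i j by force
      have "2 ^ (j div 2) \<le> n + 1" using growth[of j] i j by auto
      then have "real (j div 2) \<le> log 2 (real (n + 1))" by (rule le_log2_of_power)
      then have "j div 2 \<le> L" unfolding L_def by linarith
      then have "j \<le> 2 * L + 1" by linarith
      then show ?thesis using j m by auto
    qed simp
  qed
  then have "card {i \<in> {0..n}. q i \<noteq> p i} \<le> card ({..<b 0} \<union> (\<Union>j\<le>2 * L + 1. {b j..<b j + m}))"
    by (intro card_mono) auto
  also have "\<dots> \<le> b 0 + (\<Sum>j\<le>2 * L + 1. m)"
    by (rule order_trans[OF card_Un_le], intro add_mono order_trans[OF card_UN_le]) auto
  finally have "real (card {i \<in> {0..n}. q i \<noteq> p i}) \<le> real (b 0 + (2 * L + 2) * m)"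
    by (intro of_nat_mono) simp
  also have "\<dots> = (real (b 0) + 2 * real m) + 2 * real m * real L"
    by (simp add: algebra_simps)
  also have "\<dots> \<le> (real (b 0) + 2 * real m) + 2 * real m * log 2 (real (n + 1))"
    using L by (intro add_mono mult_left_mono) auto
  finally show "real (card {i \<in> {0..n}. q i \<noteq> p i})
      \<le> 0 * real (n + 1) + (real (b 0) + 2 * real m) + 2 * real m * log 2 (real (n + 1))"
    by simp
qed

text \<open>Gluing is applied to \<open>z\<close> and \<open>x\<close> alternately, with boundaries
  at the start of each dyadic block and at its switching point. Since \<open>0 < t < 1\<close>, both
  pieces of a block are eventually longer than the gap \<open>m\<close>.\<close>

lemma mixing_approximates_interpolate:
  assumes cl: "closedin (product_topology (\<lambda>_. discrete_topology \<Sigma>) UNIV) X"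
    and sh: "shift ` X \<subseteq> X" and mix: "mixing X"
    and x: "x \<in> X" and z: "z \<in> X" and t: "0 < t" "t < 1"
  shows "\<exists>q\<in>X. besicovitch_dist q (interpolate z t x) \<le> 0"
proof -
  obtain m where glue: "\<And>b c. \<lbrakk>\<And>j. b j + m < b (Suc j); \<And>j. c j \<in> X\<rbrakk> \<Longrightarrow>
      \<exists>q\<in>X. \<forall>j. \<forall>i\<in>{b j + m..<b (Suc j)}. q i = c j i"
    using mixing_glue[OF cl sh mix] by blast
  \<comment> \<open>From block \<open>K\<close> on, both pieces have length above
    \<open>m + 2\<close>; the extra \<open>2\<close> absorbs the rounding in
    \<open>mid\<close>.\<close>
  obtain K where K: "(real m + 2) / min t (1 - t) < 2 ^ K"
    using real_arch_pow[of 2] by auto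
  have room: "real m + 2 < t * 2 ^ k" "real m + 2 < (1 - t) * 2 ^ k" if "K \<le> k" for k
  proof -
    have "(2::real) ^ K \<le> 2 ^ k" using that by (intro power_increasing) auto
    then have "(real m + 2) / min t (1 - t) < 2 ^ k"
      using K by linarith
    then have *: "real m + 2 < 2 ^ k * min t (1 - t)"
      using t by (subst (asm) pos_divide_less_eq) auto
    have "2 ^ k * min t (1 - t) \<le> 2 ^ k * t" "2 ^ k * min t (1 - t) \<le> 2 ^ k * (1 - t)"
      by (intro mult_left_mono; simp)+
    then show "real m + 2 < t * 2 ^ k" "real m + 2 < (1 - t) * 2 ^ k"
      using * by (simp_all only: mult.commute[of _ "2 ^ k"])
  qed
  \<comment> \<open>Rounding up makes \<open>mid k\<close> the first integer at which the
    interpolation switches from \<open>z\<close> back to \<open>x\<close>.\<close>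
  define mid where "mid k = nat \<lceil>(1 + t) * 2 ^ k\<rceil>" for k :: nat
  define b where "b j = (if even j then 2 ^ (K + j div 2) else mid (K + j div 2))" for j
  define c where "c j = (if even j then z else x)" for j :: nat
  have mid1: "2 ^ k + m < mid k" if "K \<le> k" for k
  proof -
    have "real (2 ^ k + m) < (1 + t) * 2 ^ k" using room[OF that] by (simp add: algebra_simps)
    then show ?thesis unfolding mid_def by linarith
  qed
  have mid2: "mid k + m < 2 ^ Suc k" if "K \<le> k" for k
  proof -
    have "(1 + t) * 2 ^ k + 2 + real m < real (2 ^ Suc k)"
      using room[OF that] by (simp add: algebra_simps)
    moreover have "0 \<le> (1 + t) * 2 ^ k" using t by simp
    ultimately show ?thesis unfolding mid_def by linarith
  qed
  have b: "b j + m < b (Suc j)" for j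
    using mid1[of "K + j div 2"] mid2[of "K + j div 2"] by (auto simp: b_def elim!: oddE evenE)
  have growth: "2 ^ (j div 2) \<le> b j" for j
  proof -
    have "(2::nat) ^ (j div 2) \<le> 2 ^ (K + j div 2)" by (intro power_increasing) auto
    also have "\<dots> \<le> b j" using mid1[of "K + j div 2"] by (cases "even j") (simp_all add: b_def)
    finally show ?thesis .
  qed
  have agree: "c j i = interpolate z t x i" if i: "i \<in> {b j + m..<b (Suc j)}" for i j
  proof -
    define k where "k = K + j div 2"
    have mids: "2 ^ k + m < mid k" "mid k + m < 2 ^ Suc k"
      using mid1 mid2 by (simp_all add: k_def)
    have "b j = (if even j then 2 ^ k else mid k)" "b (Suc j) = (if even j then mid k else 2 ^ Suc k)"
      by (auto simp: b_def k_def elim!: oddE evenE)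
    then have range: "2 ^ k \<le> i" "i < 2 ^ Suc k" and "i < mid k \<longleftrightarrow> even j"
      using i mids by (auto split: if_splits)
    moreover have "i < mid k \<longleftrightarrow> real i < (1 + t) * 2 ^ k"
      unfolding mid_def using t by (simp add: zless_nat_eq_int_zless less_ceiling_iff)
    ultimately show ?thesis
      using dyadic_part_iff[OF range, of t] t by (simp add: interpolate_def c_def)
  qed
  obtain q where q: "q \<in> X" "\<forall>j. \<forall>i\<in>{b j + m..<b (Suc j)}. q i = c j i"
  proof -
    have "c j \<in> X" for j using x z by (simp add: c_def)
    then show ?thesis using that glue[of b c] b by blast
  qed
  have "besicovitch_dist q (interpolate z t x) \<le> 0"
    by (rule besicovitch_dist_zero_if_gaps[where b = b and m = m])
      (use b growth agree q(2) add_lessD1 in metis)+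
  then show ?thesis using q(1) by blast
qed

section \<open>The contraction\<close>

lemma mixing_subshift_contraction:
  assumes "subshift \<Sigma> X" and mix: "mixing X" and z: "z \<in> X"
  shows "homotopic_with (\<lambda>_. True) (subtopology besicovitch_topology X)
    (subtopology besicovitch_topology X) id (\<lambda>_. z)"
proof -
  let ?P = "interpolate z"
  have cl: "closedin (product_topology (\<lambda>_. discrete_topology \<Sigma>) UNIV) X" and sh: "shift ` X \<subseteq> X"
    using assms(1) by (auto simp: subshift_def)
  have "\<exists>q. q \<in> X \<and> besicovitch_dist q (?P t x) \<le> 0 \<and> (t = 0 \<longrightarrow> q = x) \<and> (t = 1 \<longrightarrow> q = z)"
    if "t \<in> {0..1}" "x \<in> X" for t x
  proof -
    consider "t = 0" | "t = 1" | "0 < t" "t < 1" using \<open>t \<in> {0..1}\<close> by force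
    then show ?thesis
    proof cases
      case 1
      have "\<not> real i < 2 ^ k" if "2 ^ k \<le> i" for i k :: nat
        using of_nat_mono[OF that, where 'a = real] by simp
      then have "dyadic_part 0 = {}"
        unfolding dyadic_part_def by auto
      then have "?P 0 x = x" by (simp add: interpolate_def)
      then show ?thesis using 1 that by auto
    next
      case 2
      have "?P 1 x i = z i" if "1 \<le> i" for i
      proof -
        obtain k where "2 ^ k \<le> i" "i < 2 ^ (k + 1)"
          using ex_power_ivl1[of 2 i] \<open>1 \<le> i\<close> by blast
        then have "i \<in> dyadic_part 1" by (subst dyadic_part_iff[of k]) (auto simp: nat_less_real_le)
        then show ?thesis by (simp add: interpolate_def)
      qed
      \<comment> \<open>Only position \<open>0\<close> can differ; it lies below
        \<open>b 0 = 1\<close>, and all gaps have length \<open>0\<close>.\<close>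
      then have "besicovitch_dist z (?P 1 x) \<le> 0"
        by (intro besicovitch_dist_zero_if_gaps[where b = "\<lambda>j. 2 ^ j" and m = 0])
          (auto simp: Suc_le_eq intro!: power_increasing)
      then show ?thesis using 2 z by auto
    next
      case 3
      then show ?thesis
        using mixing_approximates_interpolate[OF cl sh mix \<open>x \<in> X\<close> z] by auto
    qed
  qed
  \<comment> \<open>The points are chosen independently for each \<open>t\<close> and
    \<open>x\<close>; continuity comes only from their distance \<open>0\<close> to
    \<open>?P t x\<close>.\<close>
  then obtain H where H: "\<And>t x. \<lbrakk>t \<in> {0..1}; x \<in> X\<rbrakk> \<Longrightarrow> H t x \<in> X \<and>
      besicovitch_dist (H t x) (?P t x) \<le> 0 \<and> (t = 0 \<longrightarrow> H t x = x) \<and> (t = 1 \<longrightarrow> H t x = z)"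
    by metis
  have "continuous_map (prod_topology (top_of_set {0..1}) (subtopology besicovitch_topology X))
      (subtopology besicovitch_topology X) (\<lambda>(t, x). H t x)"
  proof (rule continuous_map_besicovitch_homotopy[where C = 2])
    fix t s x y assume *: "t \<in> {0..1::real}" "s \<in> {0..1::real}" "x \<in> X" "y \<in> X"
    have 1: "besicovitch_dist (H t x) (?P t x) \<le> 0" "besicovitch_dist (?P s y) (H s y) \<le> 0"
      using H * by (auto simp: besicovitch_dist_commute[of _ "H s y"])
    have 2: "besicovitch_dist (?P t x) (?P s x) \<le> 2 * \<bar>t - s\<bar>"
      using besicovitch_dist_interpolate[of s t z x] besicovitch_dist_interpolate[of t s z x]
        besicovitch_dist_commute[of "?P t x" "?P s x"] by (cases "s \<le> t") auto
    have 3: "besicovitch_dist (?P s x) (?P s y) \<le> besicovitch_dist x y"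
      by (rule besicovitch_dist_mono) (auto simp: interpolate_def split: if_splits)
    show "besicovitch_dist (case (t, x) of (t, x) \<Rightarrow> H t x) (case (s, y) of (t, x) \<Rightarrow> H t x)
        \<le> 2 * \<bar>t - s\<bar> + besicovitch_dist x y"
      \<comment> \<open>The chain runs from \<open>H t x\<close> through \<open>?P t x\<close>,
        \<open>?P s x\<close> and \<open>?P s y\<close> to \<open>H s y\<close>; its two outer links
        have length \<open>0\<close>.\<close>
      using 1 2 3 besicovitch_dist_triangle[of "H t x" "H s y" "?P t x"]
        besicovitch_dist_triangle[of "?P t x" "H s y" "?P s x"]
        besicovitch_dist_triangle[of "?P s x" "H s y" "?P s y"] by simp
  qed (use H in auto)
  moreover have "H 0 x = x" "H 1 x = z" if "x \<in> X" for x
    using H[of 0 x] H[of 1 x] that by auto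
  ultimately show ?thesis
    by (subst homotopic_with) (auto intro!: exI[of _ "\<lambda>(t, x). H t x"])
qed

theorem corollary1:
  fixes \<Sigma> :: "'a set" and X :: "(nat \<Rightarrow> 'a) set"
  assumes "finite \<Sigma>"
    and "sofic_shift \<Sigma> X"
    and "mixing X"
  shows "contractible_space (subtopology besicovitch_topology X) \<and>
    subtopology besicovitch_topology X homotopy_equivalent_space discrete_topology {()}"
proof -
  let ?X = "subtopology besicovitch_topology X"
  obtain z where z: "z \<in> X" using \<open>mixing X\<close> by (auto simp: mixing_def)
  have hom: "homotopic_with (\<lambda>_. True) ?X ?X id (\<lambda>_. z)"
    using assms z by (intro mixing_subshift_contraction) (auto simp: sofic_shift_def)
  moreover have "?X homotopy_equivalent_space discrete_topology {()}"
    unfolding homotopy_equivalent_space_def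
  proof (intro exI conjI)
    \<comment> \<open>The homotopy inverse of the collapse picks the end point \<open>z\<close> of
      the contraction, so one composite is the constant map at \<open>z\<close> and the other is the
      identity of the one-point space.\<close>
    show "continuous_map ?X (discrete_topology {()}) (\<lambda>_. ())" by simp
    show "continuous_map (discrete_topology {()}) ?X (\<lambda>_. z)" using z by simp
    show "homotopic_with (\<lambda>_. True) ?X ?X ((\<lambda>_. z) \<circ> (\<lambda>_. ())) id"
      using hom by (simp add: o_def homotopic_with_sym)
    show "homotopic_with (\<lambda>_. True) (discrete_topology {()}) (discrete_topology {()})
        ((\<lambda>_. ()) \<circ> (\<lambda>_. z)) id"
      by (rule homotopic_with_equal) auto
  qed
  ultimately show ?thesis by (auto simp: contractible_space_def)
qed

end
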